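(* Let $L(\mathbf{c})=\mathrm{span}\{X_1,\dots,X_n\}$ and $L'(\mathbf{d})=\mathrm{span}\{Y_1,\dots,Y_n\}$ be $n$-dimensional parametric complex Lie algebras with structure constants $a_{ij}^k\in\mathbb{C}[\mathbf{c}]$ and $b_{ij}^k\in\mathbb{C}[\mathbf{d}]$, where the parameters $\mathbf{c}=(c_1,\dots,c_r)$ and $\mathbf{d}=(d_1,\dots,d_s)$ range over $$\mathbf{c}\in\mathscr{C}_0=V(F_0,H_0)\subset\mathbb{C}^r,\qquad \mathbf{d}\in\mathscr{C}_1=V(F_1,H_1)\subset\mathbb{C}^s,$$ with $F_0,H_0\subset\mathbb{C}[\mathbf{c}]$ and $F_1,H_1\subset\mathbb{C}[\mathbf{d}]$ finite sets of polynomials. Let $F$ be the set of polynomials in $\mathbb{C}[z,z_{11},\dots,z_{1n},\dots,z_{n1},\dots,z_{nn},\mathbf{c},\mathbf{d}]$ consisting of - $\sum_{k=1}^n z_{kt}\,a_{ij}^k-\sum_{k,l=1}^n z_{ik}z_{jl}\,b_{kl}^t$ for $1\le i<j\le n$ and $t=1,\dots,n$; - $1-z\det[\phi]$, where $[\phi]$ is the $n\times n$ matrix whose entry in row $j$ and column $i$ is $z_{ij}$; - all $f\in F_0\cup F_1$; and let $H=H_0\cup H_1$. Let $\pi_{\mathbb{C}}^{r+s}:\mathbb{C}^{n^2+1+r+s}\to\mathbb{C}^{r+s}$ be the projection $(z,(z_{ij}),\mathbf{c},\mathbf{d})\mapsto(\mathbf{c},\mathbf{d})$ to the parameter space. Then,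 for $\mathbf{c}\in\mathscr{C}_0$ and $\mathbf{d}\in\mathscr{C}_1$, the complex Lie algebras $L(\mathbf{c})$ and $L'(\mathbf{d})$ are isomorphic if and only if $(\mathbf{c},\mathbf{d})\in\pi_{\mathbb{C}}^{r+s}(V(F,H))$.
   Context: For finite sets of polynomials $F,H$ in $m$ variables over $\mathbb{C}$, $V(F,H)\subset\mathbb{C}^m$ denotes the zero set of the constructible system $[F,H]$, i.e. the set of points of $\mathbb{C}^m$ at which $f=0$ for all $f\in F$ and $h\neq0$ for all $h\in H$. The parametric Lie algebras are given by $[X_i,X_j]=\sum_{k=1}^n a_{ij}^k(\mathbf{c})X_k$ and $[Y_i,Y_j]=\sum_{k=1}^n b_{ij}^k(\mathbf{d})Y_k$ for all $1\le i,j\le n$ (skew-symmetric in $i,j$); for each $\mathbf{c}\in\mathscr{C}_0$ (resp. $\mathbf{d}\in\mathscr{C}_1$) the values of the structure constants define a Lie algebra over $\mathbb{C}$, i.e. the Jacobi identity holds. An isomorphism of Lie algebras is a $\mathbb{C}$-linear isomorphism preserving brackets. The matrix $[\phi]$ corresponds to the linear map given by $\phi(X_i)=\sum_{k=1}^n z_{ik}Y_k$. *)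

theory Defs
  imports "HOL-Library.Poly_Mapping" "HOL-Library.FuncSet" "Jordan_Normal_Form.Determinant"
begin

text \<open>
  A polynomial is a finitely supported map from monomials to coefficients, a monomial a finitely
  supported map from variables to exponents; the ring structure is the convolution product of
  \<^theory>\<open>HOL-Library.Poly_Mapping\<close>.
\<close>

type_synonym 'v cpoly = "('v \<Rightarrow>\<^sub>0 nat) \<Rightarrow>\<^sub>0 complex"

definition Var :: "'v \<Rightarrow> 'v cpoly" where
  "Var v = Poly_Mapping.single (Poly_Mapping.single v 1) 1"

definition poly_ring :: "'v set \<Rightarrow> 'v cpoly set" where
  "poly_ring W = {f. \<forall>m \<in> Poly_Mapping.keys f. Poly_Mapping.keys m \<subseteq> W}"

definition eval_poly :: "('v \<Rightarrow> complex) \<Rightarrow> 'v cpoly \<Rightarrow> complex" where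
  "eval_poly p f = (\<Sum>m \<in> Poly_Mapping.keys f. Poly_Mapping.lookup f m *
     (\<Prod>v \<in> Poly_Mapping.keys m. p v ^ Poly_Mapping.lookup m v))"

text \<open>
  The affine space with coordinates indexed by \<open>W\<close> consists of the functions that are extensional
  on \<open>W\<close>, so that each point is represented exactly once.
\<close>

definition zero_set :: "'v set \<Rightarrow> 'v cpoly set \<Rightarrow> 'v cpoly set \<Rightarrow> ('v \<Rightarrow> complex) set" where
  "zero_set W F H =
     {p \<in> W \<rightarrow>\<^sub>E UNIV. (\<forall>f \<in> F. eval_poly p f = 0) \<and> (\<forall>h \<in> H. eval_poly p h \<noteq> 0)}"

locale complex_lie_algebra = vector_space scale
  for scale :: "complex \<Rightarrow> 'x::ab_group_add \<Rightarrow> 'x" +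
  fixes bracket :: "'x \<Rightarrow> 'x \<Rightarrow> 'x"
  assumes bracket_add_left: "bracket (x + y) w = bracket x w + bracket y w"
    and bracket_scale_left: "bracket (scale \<alpha> x) w = scale \<alpha> (bracket x w)"
    and bracket_add_right: "bracket w (x + y) = bracket w x + bracket w y"
    and bracket_scale_right: "bracket w (scale \<alpha> x) = scale \<alpha> (bracket w x)"
    and bracket_self: "bracket x x = 0"
    and jacobi: "bracket x (bracket y w) + bracket y (bracket w x) + bracket w (bracket x y) = 0"

definition lie_isomorphic ::
  "(complex \<Rightarrow> 'x::ab_group_add \<Rightarrow> 'x) \<Rightarrow> ('x \<Rightarrow> 'x \<Rightarrow> 'x) \<Rightarrow>
   (complex \<Rightarrow> 'y::ab_group_add \<Rightarrow> 'y) \<Rightarrow> ('y \<Rightarrow> 'y \<Rightarrow> 'y) \<Rightarrow> bool" where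
  "lie_isomorphic scale1 bracket1 scale2 bracket2 \<longleftrightarrow>
     (\<exists>\<phi>. Vector_Spaces.linear scale1 scale2 \<phi> \<and> bij \<phi> \<and>
          (\<forall>x y. \<phi> (bracket1 x y) = bracket2 (\<phi> x) (\<phi> y)))"

text \<open>
  A parametric Lie algebra with basis \<open>X 1, \<dots>, X n\<close>, parameter variables \<open>W\<close> and parameter domain
  \<open>S\<close>: the underlying vector space does not depend on the parameters, while the bracket is a family
  indexed by the parameter values.  The polynomial \<open>a i j k\<close> is the coefficient of \<open>X k\<close> in
  \<open>[X i, X j]\<close>; brackets at points outside \<open>S\<close> are unconstrained.
\<close>

locale parametric_lie_algebra = vector_space scale
  for scale :: "complex \<Rightarrow> 'x::ab_group_add \<Rightarrow> 'x" +
  fixes n :: nat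
    and X :: "nat \<Rightarrow> 'x"
    and W :: "'v set"
    and S :: "('v \<Rightarrow> complex) set"
    and a :: "nat \<Rightarrow> nat \<Rightarrow> nat \<Rightarrow> 'v cpoly"
    and bracket :: "('v \<Rightarrow> complex) \<Rightarrow> 'x \<Rightarrow> 'x \<Rightarrow> 'x"
  assumes basis_inj: "inj_on X {1..n}"
    and basis_independent: "independent (X ` {1..n})"
    and basis_span: "span (X ` {1..n}) = UNIV"
    and coeff_poly: "\<lbrakk>i \<in> {1..n}; j \<in> {1..n}; k \<in> {1..n}\<rbrakk> \<Longrightarrow> a i j k \<in> poly_ring W"
    and coeff_skew: "\<lbrakk>i \<in> {1..n}; j \<in> {1..n}; k \<in> {1..n}\<rbrakk> \<Longrightarrow> a i j k = - a j i k"
    and lie_algebra: "c \<in> S \<Longrightarrow> complex_lie_algebra scale (bracket c)"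
    and bracket_basis: "\<lbrakk>c \<in> S; i \<in> {1..n}; j \<in> {1..n}\<rbrakk> \<Longrightarrow>
      bracket c (X i) (X j) = (\<Sum>k = 1..n. scale (eval_poly c (a i j k)) (X k))"

text \<open>The variables \<open>z\<close>, \<open>z\<^sub>i\<^sub>j\<close>, \<open>c\<^sub>i\<close> and \<open>d\<^sub>i\<close>.\<close>

datatype var = Z | ZZ nat nat | Par_c nat | Par_d nat

definition c_vars :: "nat \<Rightarrow> var set" where
  "c_vars r = Par_c ` {1..r}"

definition d_vars :: "nat \<Rightarrow> var set" where
  "d_vars s = Par_d ` {1..s}"

definition all_vars :: "nat \<Rightarrow> nat \<Rightarrow> nat \<Rightarrow> var set" where
  "all_vars n r s = {Z} \<union> {ZZ i j |i j. i \<in> {1..n} \<and> j \<in> {1..n}} \<union> c_vars r \<union> d_vars s"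

text \<open>Matrix positions in \<^typ>\<open>'a mat\<close> count from 0, the indices of \<open>z\<^sub>i\<^sub>j\<close> from 1.\<close>

definition phi_mat :: "nat \<Rightarrow> var cpoly mat" where
  "phi_mat n = mat n n (\<lambda>(j, i). Var (ZZ (Suc i) (Suc j)))"

definition iso_system ::
  "nat \<Rightarrow> (nat \<Rightarrow> nat \<Rightarrow> nat \<Rightarrow> var cpoly) \<Rightarrow> (nat \<Rightarrow> nat \<Rightarrow> nat \<Rightarrow> var cpoly) \<Rightarrow>
   var cpoly set \<Rightarrow> var cpoly set \<Rightarrow> var cpoly set" where
  "iso_system n a b F0 F1 =
     {(\<Sum>k = 1..n. Var (ZZ k t) * a i j k)
        - (\<Sum>k = 1..n. \<Sum>l = 1..n. Var (ZZ i k) * Var (ZZ j l) * b k l t)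
      |i j t. 1 \<le> i \<and> i < j \<and> j \<le> n \<and> 1 \<le> t \<and> t \<le> n}
     \<union> {1 - Var Z * det (phi_mat n)} \<union> (F0 \<union> F1)"

text \<open>
  The product of the affine spaces over \<^term>\<open>c_vars r\<close> and \<^term>\<open>d_vars s\<close> serves as the
  parameter space.
\<close>

definition param_proj :: "nat \<Rightarrow> nat \<Rightarrow> (var \<Rightarrow> complex) \<Rightarrow> (var \<Rightarrow> complex) \<times> (var \<Rightarrow> complex)" where
  "param_proj r s p = (restrict p (c_vars r), restrict p (d_vars s))"

end

theory Submission
  imports Defs
begin

text \<open>
  A linear map is determined by its coefficients \<open>z\<^sub>i\<^sub>j\<close> on the bases. It is bijective iff its matrix
  has nonzero determinant, which the equation \<open>1 - z det = 0\<close> expresses through the extra unknown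
  \<open>z\<close>. By bilinearity and skew-symmetry it preserves the brackets iff it does so on the pairs
  \<open>X\<^sub>i, X\<^sub>j\<close> with \<open>i < j\<close>, and comparing coefficients of \<open>Y\<^sub>t\<close> gives the remaining equations.
\<close>

section \<open>Evaluation of polynomials\<close>

definition eval_monom :: "('v \<Rightarrow> complex) \<Rightarrow> ('v \<Rightarrow>\<^sub>0 nat) \<Rightarrow> complex" where
  "eval_monom p m = (\<Prod>v \<in> Poly_Mapping.keys m. p v ^ Poly_Mapping.lookup m v)"

text \<open>Variables outside the keys have exponent 0 and contribute the factor 1. A common
  superset makes monomials with different keys comparable.\<close>

lemma eval_monom_superset:
  assumes "finite A" "Poly_Mapping.keys m \<subseteq> A"
  shows "eval_monom p m = (\<Prod>v \<in> A. p v ^ Poly_Mapping.lookup m v)"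
  unfolding eval_monom_def
  by (rule prod.mono_neutral_left) (use assms in \<open>auto simp: in_keys_iff\<close>)

lemma eval_monom_add: "eval_monom p (m + m') = eval_monom p m * eval_monom p m'"
proof -
  let ?A = "Poly_Mapping.keys m \<union> Poly_Mapping.keys m'"
  have "eval_monom p (m + m') = (\<Prod>v \<in> ?A. p v ^ Poly_Mapping.lookup (m + m') v)"
    by (rule eval_monom_superset) (auto simp: Poly_Mapping.keys_add)
  also have "\<dots> = eval_monom p m * eval_monom p m'"
    by (simp add: eval_monom_superset[of ?A] lookup_add power_add prod.distrib)
  finally show ?thesis .
qed

text \<open>The additional monomials have coefficient 0. A superset is needed for sums, since
  cancellation can make the keys of \<open>f + g\<close> smaller than the union.\<close>

lemma eval_poly_superset:
  assumes "finite A" "Poly_Mapping.keys f \<subseteq> A"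
  shows "eval_poly p f = (\<Sum>m \<in> A. Poly_Mapping.lookup f m * eval_monom p m)"
  unfolding eval_poly_def eval_monom_def[symmetric]
  by (rule sum.mono_neutral_left) (use assms in \<open>auto simp: in_keys_iff\<close>)

lemma eval_poly_add: "eval_poly p (f + g) = eval_poly p f + eval_poly p g"
proof -
  let ?A = "Poly_Mapping.keys f \<union> Poly_Mapping.keys g"
  have "eval_poly p (f + g) = (\<Sum>m \<in> ?A. Poly_Mapping.lookup (f + g) m * eval_monom p m)"
    by (rule eval_poly_superset) (auto simp: Poly_Mapping.keys_add)
  also have "\<dots> = eval_poly p f + eval_poly p g"
    by (simp add: eval_poly_superset[of ?A] lookup_add distrib_right sum.distrib)
  finally show ?thesis .
qed

lemma eval_poly_0: "eval_poly p 0 = 0"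
  by (simp add: eval_poly_def)

lemma eval_poly_single: "eval_poly p (Poly_Mapping.single m x) = x * eval_monom p m"
  using eval_poly_superset[of "{m}" "Poly_Mapping.single m x" p] by (simp split: if_splits)

lemma eval_poly_1: "eval_poly p 1 = 1"
  by (simp add: eval_poly_single eval_monom_def flip: single_one)

lemma eval_poly_Var: "eval_poly p (Var v) = p v"
  by (simp add: Var_def eval_poly_single eval_monom_def)

text \<open>Building a polynomial by adding single terms, rather than by updating coefficients, fits
  the additivity of evaluation.\<close>

lemma cpoly_induct [case_names zero single_add]:
  assumes "P 0"
    and "\<And>m x f. P f \<Longrightarrow> P (Poly_Mapping.single m x + f)"
  shows "P (f :: 'v cpoly)"
proof (induction f rule: Poly_Mapping.update_induct)
  case const
  show ?case by fact
next
  case (update f m x)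
  \<comment> \<open>\<open>m\<close> is not yet a key of \<open>f\<close>, so overwriting its
    coefficient 0 amounts to adding a term.\<close>
  have "Poly_Mapping.update m x f = Poly_Mapping.single m x + f"
    using update(1)
    by (intro poly_mapping_eqI) (auto simp: lookup_update lookup_add lookup_single in_keys_iff when_def)
  then show ?case using assms(2) update by simp
qed

text \<open>Both sides are additive in each factor, so two single terms suffice; there exponents add
  and \<open>eval_monom_add\<close> applies. The outer induction treats the left factor, the inner
  one the right.\<close>

lemma eval_poly_mult: "eval_poly p (f * g) = eval_poly p f * eval_poly p g"
proof (induction f rule: cpoly_induct)
  case zero
  show ?case by (simp add: eval_poly_0)
next
  case (single_add m x f)
  have "eval_poly p (Poly_Mapping.single m x * g) = eval_poly p (Poly_Mapping.single m x) * eval_poly p g"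
  proof (induction g rule: cpoly_induct)
    case zero
    show ?case by (simp add: eval_poly_0)
  next
    case (single_add m' x' g)
    then show ?case
      by (simp add: distrib_left eval_poly_add mult_single eval_poly_single eval_monom_add)
  qed
  with single_add show ?case
    by (simp add: distrib_right eval_poly_add)
qed

text \<open>Sums, differences and determinants now pass through evaluation by the general facts on
  ring homomorphisms.\<close>

interpretation eval_poly: comm_ring_hom "eval_poly p" for p
  by unfold_locales (simp_all add: eval_poly_0 eval_poly_1 eval_poly_add eval_poly_mult)

text \<open>For transferring values between a point of the big affine space and its restriction to
  the parameter variables.\<close>

lemma eval_poly_cong:
  assumes "f \<in> poly_ring W" "\<And>v. v \<in> W \<Longrightarrow> p v = q v"
  shows "eval_poly p f = eval_poly q f"
  unfolding eval_poly_def
  by (intro sum.cong prod.cong refl arg_cong2[of _ _ _ _ "(*)"])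
     (use assms in \<open>auto simp: poly_ring_def subset_iff\<close>)

lemma eval_det_phi_mat:
  "eval_poly p (det (phi_mat n)) = det (mat n n (\<lambda>(j, i). p (ZZ (Suc i) (Suc j))))"
proof -
  have "map_mat (eval_poly p) (phi_mat n) = mat n n (\<lambda>(j, i). p (ZZ (Suc i) (Suc j)))"
    by (rule eq_matI) (auto simp: phi_mat_def eval_poly_Var)
  then show ?thesis
    by (metis eval_poly.hom_det)
qed

section \<open>Linear maps between based spaces\<close>

lemma index_mat_mult_from_1:
  assumes "k < n" "l < n"
  shows "(mat n n (\<lambda>(i, j). u (Suc i) (Suc j)) * mat n n (\<lambda>(i, j). v (Suc i) (Suc j))) $$ (k, l)
    = (\<Sum>i = 1..n. u (Suc k) i * v i (Suc l))"
  using assms by (simp add: scalar_prod_def sum.atLeast1_atMost_eq atLeast0LessThan)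

text \<open>A nonzero determinant makes \<open>M\<close> a unit of the matrix ring, with a two-sided
  inverse. Conversely, multiplicativity of \<open>det\<close> and a one-sided inverse exclude
  determinant 0.\<close>

lemma det_nonzero_iff_inverse_mat:
  fixes M :: "'a::field mat"
  assumes M: "M \<in> carrier_mat n n"
  shows "det M \<noteq> 0 \<longleftrightarrow> (\<exists>W \<in> carrier_mat n n. W * M = 1\<^sub>m n)"
    and "det M \<noteq> 0 \<longleftrightarrow> (\<exists>W \<in> carrier_mat n n. M * W = 1\<^sub>m n)"
proof -
  have unit: "\<exists>W \<in> carrier_mat n n. W * M = 1\<^sub>m n \<and> M * W = 1\<^sub>m n" if "det M \<noteq> 0"
    using det_non_zero_imp_unit[OF M that, of "()"] unfolding Units_def ring_mat_def by auto
  have nz: "det M \<noteq> 0" if W: "W \<in> carrier_mat n n" and "W * M = 1\<^sub>m n \<or> M * W = 1\<^sub>m n" for W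
  proof -
    have "det W * det M = 1 \<or> det M * det W = 1"
      using that(2) det_mult[OF W M] det_mult[OF M W] by (metis det_one)
    then show ?thesis by auto
  qed
  show "det M \<noteq> 0 \<longleftrightarrow> (\<exists>W \<in> carrier_mat n n. W * M = 1\<^sub>m n)"
    and "det M \<noteq> 0 \<longleftrightarrow> (\<exists>W \<in> carrier_mat n n. M * W = 1\<^sub>m n)"
    using unit nz by blast+
qed

text \<open>Invertibility in terms of coefficient sums with indices from 1, the form in which
  coordinates of vectors are compared.\<close>

lemma det_nonzero_iff_inverse:
  fixes z :: "nat \<Rightarrow> nat \<Rightarrow> complex"
  shows "det (mat n n (\<lambda>(j, i). z (Suc i) (Suc j))) \<noteq> 0 \<longleftrightarrow>
    (\<exists>w. \<forall>k \<in> {1..n}. \<forall>l \<in> {1..n}. (\<Sum>i = 1..n. w k i * z i l) = (if k = l then 1 else 0))"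
    (is "?det \<longleftrightarrow> ?left")
  and "det (mat n n (\<lambda>(j, i). z (Suc i) (Suc j))) \<noteq> 0 \<longleftrightarrow>
    (\<exists>w. \<forall>k \<in> {1..n}. \<forall>l \<in> {1..n}. (\<Sum>i = 1..n. z k i * w i l) = (if k = l then 1 else 0))"
    (is "?det \<longleftrightarrow> ?right")
proof -
  let ?M = "\<lambda>u. mat n n (\<lambda>(i, j). u (Suc i) (Suc j)) :: complex mat"
  \<comment> \<open>The matrix has \<open>z i j\<close> in row \<open>j\<close> and column
    \<open>i\<close>, hence is the transpose of the one multiplied in the sums.\<close>
  have "mat n n (\<lambda>(j, i). z (Suc i) (Suc j)) = transpose_mat (?M z)"
    by (rule eq_matI) auto
  then have det: "det (mat n n (\<lambda>(j, i). z (Suc i) (Suc j))) = det (?M z)"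
    by (simp add: det_transpose[of _ n])
  have one: "?M u * ?M v = 1\<^sub>m n \<longleftrightarrow>
      (\<forall>k \<in> {1..n}. \<forall>l \<in> {1..n}. (\<Sum>i = 1..n. u k i * v i l) = (if k = l then 1 else 0))"
    (is "?A \<longleftrightarrow> ?B") for u v
  proof
    assume A: ?A
    show ?B
    proof (intro ballI)
      fix k l assume kl: "k \<in> {1..n}" "l \<in> {1..n}"
      then have *: "k - 1 < n" "l - 1 < n" "Suc (k - 1) = k" "Suc (l - 1) = l" by auto
      have "(?M u * ?M v) $$ (k - 1, l - 1) = 1\<^sub>m n $$ (k - 1, l - 1)" using A by simp
      then show "(\<Sum>i = 1..n. u k i * v i l) = (if k = l then 1 else 0)"
        unfolding index_mat_mult_from_1[OF *(1,2)] using * by (auto split: if_splits)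
    qed
  next
    assume B: ?B
    show ?A
    proof (rule eq_matI)
      fix k l assume "k < dim_row (1\<^sub>m n :: complex mat)" "l < dim_col (1\<^sub>m n :: complex mat)"
      then have *: "k < n" "l < n" by auto
      show "(?M u * ?M v) $$ (k, l) = 1\<^sub>m n $$ (k, l)"
        unfolding index_mat_mult_from_1[OF *] using * B by simp
    qed auto
  qed
  \<comment> \<open>Every \<open>n\<close> by \<open>n\<close> matrix is some \<open>?M w\<close>,
    after shifting indices by 1, so the two kinds of existential quantifier agree.\<close>
  have ex: "(\<exists>w. P (?M w)) \<longleftrightarrow> (\<exists>W \<in> carrier_mat n n. P W)" for P
  proof
    assume "\<exists>W \<in> carrier_mat n n. P W"
    then obtain W where W: "W \<in> carrier_mat n n" "P W" by blast
    have "?M (\<lambda>i j. W $$ (i - 1, j - 1)) = W"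
      by (rule eq_matI) (use W in auto)
    with W(2) have "P (?M (\<lambda>i j. W $$ (i - 1, j - 1)))" by (simp only:)
    then show "\<exists>w. P (?M w)" by (rule exI[of "\<lambda>w. P (?M w)"])
  qed (meson mat_carrier)
  show "?det \<longleftrightarrow> ?left"
    using det_nonzero_iff_inverse_mat(1)[OF mat_carrier, of n "\<lambda>(i, j). z (Suc i) (Suc j)"]
    unfolding det one[symmetric] ex[of "\<lambda>W. W * ?M z = 1\<^sub>m n", symmetric] .
  show "?det \<longleftrightarrow> ?right"
    using det_nonzero_iff_inverse_mat(2)[OF mat_carrier, of n "\<lambda>(i, j). z (Suc i) (Suc j)"]
    unfolding det one[symmetric] ex[of "\<lambda>W. ?M z * W = 1\<^sub>m n", symmetric] .
qed

section \<open>Coordinates with respect to an indexed basis\<close>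

locale indexed_basis = vector_space scale
  for scale :: "complex \<Rightarrow> 'x::ab_group_add \<Rightarrow> 'x" +
  fixes n :: nat and X :: "nat \<Rightarrow> 'x"
  assumes inj: "inj_on X {1..n}"
    and indep: "independent (X ` {1..n})"
    and spanning: "span (X ` {1..n}) = UNIV"
begin

lemma coordinates_exist:
  obtains f where "x = (\<Sum>k = 1..n. scale (f k) (X k))"
proof -
  have "x \<in> range (\<lambda>u. \<Sum>v \<in> X ` {1..n}. scale (u v) v)"
    using spanning span_finite[of "X ` {1..n}"] by auto
  then obtain u where "x = (\<Sum>v \<in> X ` {1..n}. scale (u v) v)" by auto
  also have "\<dots> = (\<Sum>k = 1..n. scale (u (X k)) (X k))"
    by (subst sum.reindex[OF inj]) simp
  finally show thesis using that[of "\<lambda>k. u (X k)"] by simp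
qed

lemma coordinates_eq_iff:
  "(\<Sum>k = 1..n. scale (f k) (X k)) = (\<Sum>k = 1..n. scale (g k) (X k)) \<longleftrightarrow> (\<forall>k \<in> {1..n}. f k = g k)"
proof
  assume eq: "(\<Sum>k = 1..n. scale (f k) (X k)) = (\<Sum>k = 1..n. scale (g k) (X k))"
  \<comment> \<open>Independence speaks of coefficients attached to vectors; \<open>inv_into\<close>
    leads from a vector back to its index, by injectivity of \<open>X\<close> on
    \<open>{1..n}\<close>.\<close>
  let ?u = "\<lambda>v. f (inv_into {1..n} X v) - g (inv_into {1..n} X v)"
  have "(\<Sum>v \<in> X ` {1..n}. scale (?u v) v) = (\<Sum>k = 1..n. scale (f k - g k) (X k))"
    by (subst sum.reindex[OF inj]) (simp add: inv_into_f_f[OF inj] del: One_nat_def)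
  also have "\<dots> = 0"
    using eq by (simp add: scale_left_diff_distrib sum_subtractf)
  finally have "?u (X k) = 0" if "k \<in> {1..n}" for k
    using independentD[OF indep, of "X ` {1..n}" ?u] that by blast
  then show "\<forall>k \<in> {1..n}. f k = g k"
    by (auto simp: inv_into_f_f[OF inj] simp del: One_nat_def)
qed auto

lemma basis_eq_sum: "i \<in> {1..n} \<Longrightarrow> X i = (\<Sum>k = 1..n. scale (if i = k then 1 else 0) (X k))"
  by (simp add: if_distrib[of "\<lambda>c. scale c _"] cong: if_cong)

end

locale indexed_basis_pair =
  VX: indexed_basis scaleX n X + VY: indexed_basis scaleY n Y
  for scaleX :: "complex \<Rightarrow> 'x::ab_group_add \<Rightarrow> 'x" and scaleY :: "complex \<Rightarrow> 'y::ab_group_add \<Rightarrow> 'y"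
    and n X Y
begin

sublocale vector_space_pair scaleX scaleY ..

text \<open>A linear map can be prescribed on an independent set. This turns a solution
  \<open>z\<close> of the equations into a map.\<close>

lemma linear_with_coefficients:
  obtains \<phi> where "Vector_Spaces.linear scaleX scaleY \<phi>"
    "\<And>i. i \<in> {1..n} \<Longrightarrow> \<phi> (X i) = (\<Sum>k = 1..n. scaleY (z i k) (Y k))"
proof -
  obtain \<phi> where "Vector_Spaces.linear scaleX scaleY \<phi>"
    "\<forall>x \<in> X ` {1..n}. \<phi> x = (\<Sum>k = 1..n. scaleY (z (inv_into {1..n} X x) k) (Y k))"
    using linear_independent_extend[OF VX.indep,
        of "\<lambda>x. \<Sum>k = 1..n. scaleY (z (inv_into {1..n} X x) k) (Y k)"] by blast
  then show thesis using that by (auto simp: inv_into_f_f[OF VX.inj] simp del: One_nat_def)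
qed

context
  fixes \<phi> z
  assumes lin: "Vector_Spaces.linear scaleX scaleY \<phi>"
    and coeff: "\<And>i. i \<in> {1..n} \<Longrightarrow> \<phi> (X i) = (\<Sum>k = 1..n. scaleY (z i k) (Y k))"
begin

text \<open>Coordinates transform as a row vector times the array \<open>z\<close>; transposed, this
  is the matrix of \<phi> acting on columns.\<close>

lemma image_coordinates:
  "\<phi> (\<Sum>i = 1..n. scaleX (f i) (X i)) = (\<Sum>k = 1..n. scaleY (\<Sum>i = 1..n. f i * z i k) (Y k))"
proof -
  have "\<phi> (\<Sum>i = 1..n. scaleX (f i) (X i)) = (\<Sum>i = 1..n. scaleY (f i) (\<Sum>k = 1..n. scaleY (z i k) (Y k)))"
    by (simp add: linear_sum[OF lin] linear_scale[OF lin] coeff)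
  also have "\<dots> = (\<Sum>i = 1..n. \<Sum>k = 1..n. scaleY (f i * z i k) (Y k))"
    by (simp add: VY.scale_sum_right)
  also have "\<dots> = (\<Sum>k = 1..n. \<Sum>i = 1..n. scaleY (f i * z i k) (Y k))"
    by (rule sum.swap)
  finally show ?thesis by (simp add: VY.scale_sum_left)
qed

text \<open>Coordinates of a preimage of \<open>Y k\<close> form row \<open>k\<close> of a left
  inverse of \<open>z\<close>. Conversely, a right inverse makes the kernel trivial, and a left
  inverse puts every \<open>Y k\<close> into the range.\<close>

lemma bij_iff_det: "bij \<phi> \<longleftrightarrow> det (mat n n (\<lambda>(j, i). z (Suc i) (Suc j))) \<noteq> 0"
proof
  assume "bij \<phi>"
  then have "\<exists>f. \<phi> (\<Sum>i = 1..n. scaleX (f i) (X i)) = Y k" for k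
    by (metis VX.coordinates_exist bij_pointE)
  then obtain w where w: "\<phi> (\<Sum>i = 1..n. scaleX (w k i) (X i)) = Y k" for k
    by metis
  have "(\<Sum>i = 1..n. w k i * z i l) = (if k = l then 1 else 0)" if "k \<in> {1..n}" "l \<in> {1..n}" for k l
  proof -
    have "(\<Sum>l = 1..n. scaleY (\<Sum>i = 1..n. w k i * z i l) (Y l)) =
        (\<Sum>l = 1..n. scaleY (if k = l then 1 else 0) (Y l))"
      using w[of k] unfolding image_coordinates VY.basis_eq_sum[OF that(1)] .
    then show ?thesis using that(2) unfolding VY.coordinates_eq_iff by blast
  qed
  then show "det (mat n n (\<lambda>(j, i). z (Suc i) (Suc j))) \<noteq> 0"
    unfolding det_nonzero_iff_inverse(1) by blast
next
  assume det: "det (mat n n (\<lambda>(j, i). z (Suc i) (Suc j))) \<noteq> 0"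
  have "inj \<phi>"
    unfolding linear_inj_iff_eq_0[OF lin]
  proof (intro allI impI)
    fix x assume x: "\<phi> x = 0"
    obtain f where f: "x = (\<Sum>i = 1..n. scaleX (f i) (X i))" by (rule VX.coordinates_exist)
    obtain w where w: "\<forall>k \<in> {1..n}. \<forall>l \<in> {1..n}. (\<Sum>i = 1..n. z k i * w i l) = (if k = l then 1 else 0)"
      using det unfolding det_nonzero_iff_inverse(2) by blast
    have "(\<Sum>k = 1..n. scaleY (\<Sum>i = 1..n. f i * z i k) (Y k)) = (\<Sum>k = 1..n. scaleY 0 (Y k))"
      using x unfolding f image_coordinates by simp
    then have 0: "(\<Sum>i = 1..n. f i * z i k) = 0" if "k \<in> {1..n}" for k
      using that unfolding VY.coordinates_eq_iff by blast
    have "f l = 0" if l: "l \<in> {1..n}" for l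
    proof -
      \<comment> \<open>As row vectors: f = f (z w) = (f z) w = 0.\<close>
      have "f l = (\<Sum>i = 1..n. f i * (if i = l then 1 else 0))"
        using l by (simp add: if_distrib cong: if_cong)
      also have "\<dots> = (\<Sum>i = 1..n. f i * (\<Sum>k = 1..n. z i k * w k l))"
        by (rule sum.cong) (use w l in auto)
      also have "\<dots> = (\<Sum>i = 1..n. \<Sum>k = 1..n. f i * z i k * w k l)"
        by (simp add: sum_distrib_left mult.assoc)
      also have "\<dots> = (\<Sum>k = 1..n. (\<Sum>i = 1..n. f i * z i k) * w k l)"
        by (subst sum.swap) (simp add: sum_distrib_right)
      also have "\<dots> = 0"
        by (rule sum.neutral) (use 0 in auto)
      finally show ?thesis .
    qed
    then show "x = 0" unfolding f by simp
  qed
  moreover have "surj \<phi>"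
  proof -
    obtain w where w: "\<forall>k \<in> {1..n}. \<forall>l \<in> {1..n}. (\<Sum>i = 1..n. w k i * z i l) = (if k = l then 1 else 0)"
      using det unfolding det_nonzero_iff_inverse(1) by blast
    have "Y k \<in> range \<phi>" if "k \<in> {1..n}" for k
    proof -
      have "\<phi> (\<Sum>i = 1..n. scaleX (w k i) (X i)) = (\<Sum>l = 1..n. scaleY (if k = l then 1 else 0) (Y l))"
        unfolding image_coordinates using w that by (auto simp: VY.coordinates_eq_iff)
      then show ?thesis using VY.basis_eq_sum[OF that] by (metis rangeI)
    qed
    moreover have "VY.subspace (range \<phi>)"
      using linear_subspace_image[OF lin VX.subspace_UNIV] .
    ultimately have "VY.span (Y ` {1..n}) \<subseteq> range \<phi>"
      by (intro VY.span_minimal) auto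
    then show ?thesis using VY.spanning by auto
  qed
  ultimately show "bij \<phi>" by (simp add: bij_def)
qed

end

end

section \<open>Bracket-preserving maps\<close>

context complex_lie_algebra
begin

lemma linear_bracket_left: "Vector_Spaces.linear scale scale (\<lambda>x. bracket x y)"
  by (simp add: Vector_Spaces.linear_iff bracket_add_left bracket_scale_left vector_space_axioms)

lemma linear_bracket_right: "Vector_Spaces.linear scale scale (bracket x)"
  by (simp add: Vector_Spaces.linear_iff bracket_add_right bracket_scale_right vector_space_axioms)

text \<open>Polarization: the bracket of \<open>x + y\<close> with itself vanishes and is
  expanded.\<close>

lemma bracket_skew: "bracket x y = - bracket y x"
proof -
  have "bracket (x + y) (x + y) = bracket x y + bracket y x"
    unfolding bracket_add_left bracket_add_right by (simp add: bracket_self)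
  then show ?thesis by (simp add: bracket_self eq_neg_iff_add_eq_0)
qed

end

text \<open>A parametric Lie algebra frozen at one parameter point: the structure constants are
  numbers instead of polynomials.\<close>

locale based_lie_algebra = indexed_basis scale n X + complex_lie_algebra scale bracket
  for scale :: "complex \<Rightarrow> 'x::ab_group_add \<Rightarrow> 'x" and n X bracket +
  fixes A :: "nat \<Rightarrow> nat \<Rightarrow> nat \<Rightarrow> complex"
  assumes structure_constants:
    "\<lbrakk>i \<in> {1..n}; j \<in> {1..n}\<rbrakk> \<Longrightarrow> bracket (X i) (X j) = (\<Sum>k = 1..n. scale (A i j k) (X k))"
begin

lemma bracket_coordinates:
  "bracket (\<Sum>k = 1..n. scale (f k) (X k)) (\<Sum>l = 1..n. scale (g l) (X l)) =
    (\<Sum>t = 1..n. scale (\<Sum>k = 1..n. \<Sum>l = 1..n. f k * g l * A k l t) (X t))"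
proof -
  interpret vector_space_pair scale scale ..
  have "bracket (\<Sum>k = 1..n. scale (f k) (X k)) (\<Sum>l = 1..n. scale (g l) (X l)) =
      (\<Sum>k = 1..n. scale (f k) (\<Sum>l = 1..n. scale (g l) (bracket (X k) (X l))))"
    unfolding linear_sum[OF linear_bracket_left] bracket_scale_left
    by (simp add: linear_sum[OF linear_bracket_right] bracket_scale_right)
  also have "\<dots> = (\<Sum>k = 1..n. \<Sum>l = 1..n. \<Sum>t = 1..n. scale (f k * g l * A k l t) (X t))"
    by (simp add: structure_constants scale_sum_right mult.assoc)
  \<comment> \<open>Two interchanges carry the sum over \<open>t\<close> outward, past
    \<open>l\<close> and then past \<open>k\<close>, to collect the coefficient of
    \<open>X t\<close>.\<close>
  also have "\<dots> = (\<Sum>k = 1..n. \<Sum>t = 1..n. \<Sum>l = 1..n. scale (f k * g l * A k l t) (X t))"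
    by (intro sum.cong refl sum.swap)
  also have "\<dots> = (\<Sum>t = 1..n. \<Sum>k = 1..n. \<Sum>l = 1..n. scale (f k * g l * A k l t) (X t))"
    by (rule sum.swap)
  finally show ?thesis by (simp add: scale_sum_left)
qed

end

locale based_lie_algebra_pair =
  LX: based_lie_algebra scaleX n X bracketX A + LY: based_lie_algebra scaleY n Y bracketY B
  for scaleX :: "complex \<Rightarrow> 'x::ab_group_add \<Rightarrow> 'x" and scaleY :: "complex \<Rightarrow> 'y::ab_group_add \<Rightarrow> 'y"
    and n X Y bracketX bracketY A B
begin

sublocale indexed_basis_pair scaleX scaleY n X Y ..

context
  fixes \<phi> z
  assumes lin: "Vector_Spaces.linear scaleX scaleY \<phi>"
    and coeff: "\<And>i. i \<in> {1..n} \<Longrightarrow> \<phi> (X i) = (\<Sum>k = 1..n. scaleY (z i k) (Y k))"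
begin

text \<open>On basis pairs, the diagonal case is 0 = 0 and the case \<open>i > j\<close> follows by
  skew-symmetry; bilinearity then covers all vectors.\<close>

lemma preserves_bracket_iff_basis:
  "(\<forall>x y. \<phi> (bracketX x y) = bracketY (\<phi> x) (\<phi> y)) \<longleftrightarrow>
    (\<forall>i j. 1 \<le> i \<and> i < j \<and> j \<le> n \<longrightarrow> \<phi> (bracketX (X i) (X j)) = bracketY (\<phi> (X i)) (\<phi> (X j)))"
proof (intro iffI allI)
  fix x y
  assume upper: "\<forall>i j. 1 \<le> i \<and> i < j \<and> j \<le> n \<longrightarrow> \<phi> (bracketX (X i) (X j)) = bracketY (\<phi> (X i)) (\<phi> (X j))"
  have basis: "\<phi> (bracketX (X i) (X j)) = bracketY (\<phi> (X i)) (\<phi> (X j))"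
    if "i \<in> {1..n}" "j \<in> {1..n}" for i j
  proof (cases i j rule: linorder_cases)
    case less
    then show ?thesis using upper that by auto
  next
    case equal
    then show ?thesis by (simp add: LX.bracket_self LY.bracket_self linear_0[OF lin])
  next
    case greater
    have "\<phi> (bracketX (X i) (X j)) = - \<phi> (bracketX (X j) (X i))"
      by (subst LX.bracket_skew) (rule linear_neg[OF lin])
    also have "\<dots> = bracketY (\<phi> (X i)) (\<phi> (X j))"
      using upper that greater by (subst LY.bracket_skew) auto
    finally show ?thesis .
  qed
  \<comment> \<open>With one argument fixed, both sides are linear in the other. Equality spreads
    from the basis first in the left argument, then in the right.\<close>
  have lin1: "Vector_Spaces.linear scaleX scaleY (\<lambda>x. \<phi> (bracketX x y))"
    "Vector_Spaces.linear scaleX scaleY (\<lambda>x. bracketY (\<phi> x) (\<phi> y))" for y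
    using Vector_Spaces.linear_compose[OF LX.linear_bracket_left lin]
      Vector_Spaces.linear_compose[OF lin LY.linear_bracket_left] by (simp_all add: comp_def)
  have lin2: "Vector_Spaces.linear scaleX scaleY (\<lambda>y. \<phi> (bracketX x y))"
    "Vector_Spaces.linear scaleX scaleY (\<lambda>y. bracketY (\<phi> x) (\<phi> y))" for x
    using Vector_Spaces.linear_compose[OF LX.linear_bracket_right lin]
      Vector_Spaces.linear_compose[OF lin LY.linear_bracket_right] by (simp_all add: comp_def)
  have "\<phi> (bracketX x (X j)) = bracketY (\<phi> x) (\<phi> (X j))" if "j \<in> {1..n}" for x j
    by (rule linear_eq_on_span[OF lin1[of "X j"], of "X ` {1..n}" x])
      (use basis that LX.spanning in auto)
  then show "\<phi> (bracketX x y) = bracketY (\<phi> x) (\<phi> y)"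
    by - (rule linear_eq_on_span[OF lin2[of x], of "X ` {1..n}" y], use LX.spanning in auto)
qed auto

text \<open>\<open>image_coordinates\<close> expands one side in the \<open>Y t\<close>,
  \<open>bracket_coordinates\<close> the other; uniqueness of coordinates gives one equation per
  \<open>t\<close>.\<close>

lemma preserves_bracket_iff:
  "(\<forall>x y. \<phi> (bracketX x y) = bracketY (\<phi> x) (\<phi> y)) \<longleftrightarrow>
    (\<forall>i j t. 1 \<le> i \<and> i < j \<and> j \<le> n \<and> 1 \<le> t \<and> t \<le> n \<longrightarrow>
      (\<Sum>k = 1..n. z k t * A i j k) - (\<Sum>k = 1..n. \<Sum>l = 1..n. z i k * z j l * B k l t) = 0)"
proof -
  have "\<phi> (bracketX (X i) (X j)) = bracketY (\<phi> (X i)) (\<phi> (X j)) \<longleftrightarrow>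
      (\<forall>t \<in> {1..n}. (\<Sum>k = 1..n. z k t * A i j k) - (\<Sum>k = 1..n. \<Sum>l = 1..n. z i k * z j l * B k l t) = 0)"
    if "1 \<le> i \<and> i < j \<and> j \<le> n" for i j
  proof -
    have ij: "i \<in> {1..n}" "j \<in> {1..n}" using that by auto
    have "\<phi> (bracketX (X i) (X j)) = (\<Sum>t = 1..n. scaleY (\<Sum>k = 1..n. A i j k * z k t) (Y t))"
      unfolding LX.structure_constants[OF ij] by (rule image_coordinates[OF lin coeff])
    moreover have "bracketY (\<phi> (X i)) (\<phi> (X j)) =
        (\<Sum>t = 1..n. scaleY (\<Sum>k = 1..n. \<Sum>l = 1..n. z i k * z j l * B k l t) (Y t))"
      unfolding coeff[OF ij(1)] coeff[OF ij(2)] by (rule LY.bracket_coordinates)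
    ultimately show ?thesis
      by (simp only: LY.coordinates_eq_iff right_minus_eq mult.commute[of "A _ _ _"])
  qed
  then show ?thesis
    unfolding preserves_bracket_iff_basis Ball_def atLeastAtMost_iff by simp blast
qed

end

text \<open>The criterion at fixed parameter values: maps are replaced by coefficient arrays, and
  the auxiliary unknown for the inverse determinant has not yet entered.\<close>

theorem lie_isomorphic_iff_coefficients:
  "lie_isomorphic scaleX bracketX scaleY bracketY \<longleftrightarrow>
    (\<exists>z. det (mat n n (\<lambda>(j, i). z (Suc i) (Suc j))) \<noteq> 0 \<and>
      (\<forall>i j t. 1 \<le> i \<and> i < j \<and> j \<le> n \<and> 1 \<le> t \<and> t \<le> n \<longrightarrow>
        (\<Sum>k = 1..n. z k t * A i j k) - (\<Sum>k = 1..n. \<Sum>l = 1..n. z i k * z j l * B k l t) = 0))"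
    (is "_ \<longleftrightarrow> (\<exists>z. ?P z)")
proof
  assume "lie_isomorphic scaleX bracketX scaleY bracketY"
  then obtain \<phi> where \<phi>: "Vector_Spaces.linear scaleX scaleY \<phi>" "bij \<phi>"
    "\<forall>x y. \<phi> (bracketX x y) = bracketY (\<phi> x) (\<phi> y)"
    unfolding lie_isomorphic_def by (elim exE conjE)
  have "\<exists>f. \<phi> (X i) = (\<Sum>k = 1..n. scaleY (f k) (Y k))" for i
    by (metis LY.coordinates_exist)
  then obtain z where z: "\<phi> (X i) = (\<Sum>k = 1..n. scaleY (z i k) (Y k))" for i
    by metis
  have "?P z"
    using \<phi> bij_iff_det[OF \<phi>(1) z] preserves_bracket_iff[OF \<phi>(1) z] by blast
  then show "\<exists>z. ?P z" by blast
next
  assume "\<exists>z. ?P z"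
  then obtain z where z: "?P z" by blast
  obtain \<phi> where \<phi>: "Vector_Spaces.linear scaleX scaleY \<phi>"
    "\<And>i. i \<in> {1..n} \<Longrightarrow> \<phi> (X i) = (\<Sum>k = 1..n. scaleY (z i k) (Y k))"
    using linear_with_coefficients[of z] by blast
  then have "bij \<phi>" "\<forall>x y. \<phi> (bracketX x y) = bracketY (\<phi> x) (\<phi> y)"
    using z bij_iff_det[OF \<phi>] preserves_bracket_iff[OF \<phi>] by blast+
  with \<phi>(1) show "lie_isomorphic scaleX bracketX scaleY bracketY"
    unfolding lie_isomorphic_def by blast
qed

end

lemma (in parametric_lie_algebra) based_lie_algebra_at:
  assumes "c \<in> S"
  shows "based_lie_algebra scale n X (bracket c) (\<lambda>i j k. eval_poly c (a i j k))"
proof -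
  interpret complex_lie_algebra scale "bracket c" using assms by (rule lie_algebra)
  show ?thesis
    by unfold_locales (use assms bracket_basis basis_inj basis_independent basis_span in auto)
qed

section \<open>The constructible system\<close>

text \<open>Evaluation is a ring homomorphism, so every polynomial of the system turns into its
  numerical counterpart.\<close>

lemma iso_system_zero_iff:
  "(\<forall>f \<in> iso_system n a b F0 F1. eval_poly p f = 0) \<longleftrightarrow>
    (\<forall>i j t. 1 \<le> i \<and> i < j \<and> j \<le> n \<and> 1 \<le> t \<and> t \<le> n \<longrightarrow>
      (\<Sum>k = 1..n. p (ZZ k t) * eval_poly p (a i j k))
        - (\<Sum>k = 1..n. \<Sum>l = 1..n. p (ZZ i k) * p (ZZ j l) * eval_poly p (b k l t)) = 0) \<and>
    p Z * det (mat n n (\<lambda>(j, i). p (ZZ (Suc i) (Suc j)))) = 1 \<and>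
    (\<forall>f \<in> F0. eval_poly p f = 0) \<and> (\<forall>f \<in> F1. eval_poly p f = 0)"
proof -
  have "eval_poly p ((\<Sum>k = 1..n. Var (ZZ k t) * a i j k)
        - (\<Sum>k = 1..n. \<Sum>l = 1..n. Var (ZZ i k) * Var (ZZ j l) * b k l t)) =
      (\<Sum>k = 1..n. p (ZZ k t) * eval_poly p (a i j k))
        - (\<Sum>k = 1..n. \<Sum>l = 1..n. p (ZZ i k) * p (ZZ j l) * eval_poly p (b k l t))" for i j t
    by (simp add: eval_poly.hom_minus eval_poly.hom_sum eval_poly_mult eval_poly_Var)
  moreover have "eval_poly p (1 - Var Z * det (phi_mat n)) =
      1 - p Z * det (mat n n (\<lambda>(j, i). p (ZZ (Suc i) (Suc j))))"
    by (simp add: eval_poly.hom_minus eval_poly_1 eval_poly_mult eval_poly_Var eval_det_phi_mat)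
  moreover have "(\<forall>f \<in> {g i j t |i j t. Q i j t}. P f) \<longleftrightarrow> (\<forall>i j t. Q i j t \<longrightarrow> P (g i j t))"
    for g :: "nat \<Rightarrow> nat \<Rightarrow> nat \<Rightarrow> var cpoly" and P Q
    by blast
  ultimately show ?thesis
    unfolding iso_system_def ball_Un
    by (simp only: ball_simps right_minus_eq conj_assoc simp_thms eq_commute[of 1])
qed

text \<open>The restriction is extensional by construction, so only the constraints remain. This
  lets the hypotheses on \<open>c\<close> and \<open>d\<close> be read as constraints on a point
  above them.\<close>

lemma zero_set_restrict:
  assumes "F \<subseteq> poly_ring W" "H \<subseteq> poly_ring W"
  shows "restrict p W \<in> zero_set W F H \<longleftrightarrow>
    (\<forall>f \<in> F. eval_poly p f = 0) \<and> (\<forall>h \<in> H. eval_poly p h \<noteq> 0)"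
proof -
  have "eval_poly (restrict p W) f = eval_poly p f" if "f \<in> poly_ring W" for f
    using that by (rule eval_poly_cong) auto
  then show ?thesis using assms unfolding zero_set_def by (auto simp: subset_iff)
qed

theorem theorem6p1:
  fixes n r s :: nat
    and F0 H0 F1 H1 :: "var cpoly set"
    and scaleX :: "complex \<Rightarrow> 'x::ab_group_add \<Rightarrow> 'x"
    and scaleY :: "complex \<Rightarrow> 'y::ab_group_add \<Rightarrow> 'y"
    and X :: "nat \<Rightarrow> 'x" and Y :: "nat \<Rightarrow> 'y"
    and a b :: "nat \<Rightarrow> nat \<Rightarrow> nat \<Rightarrow> var cpoly"
    and bracketX :: "(var \<Rightarrow> complex) \<Rightarrow> 'x \<Rightarrow> 'x \<Rightarrow> 'x"
    and bracketY :: "(var \<Rightarrow> complex) \<Rightarrow> 'y \<Rightarrow> 'y \<Rightarrow> 'y"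
    and c d :: "var \<Rightarrow> complex"
  assumes "finite F0" "finite H0" "F0 \<subseteq> poly_ring (c_vars r)" "H0 \<subseteq> poly_ring (c_vars r)"
    and "finite F1" "finite H1" "F1 \<subseteq> poly_ring (d_vars s)" "H1 \<subseteq> poly_ring (d_vars s)"
    and "parametric_lie_algebra scaleX n X (c_vars r) (zero_set (c_vars r) F0 H0) a bracketX"
    and "parametric_lie_algebra scaleY n Y (d_vars s) (zero_set (d_vars s) F1 H1) b bracketY"
    and "c \<in> zero_set (c_vars r) F0 H0" and "d \<in> zero_set (d_vars s) F1 H1"
  shows "lie_isomorphic scaleX (bracketX c) scaleY (bracketY d) \<longleftrightarrow>
    (c, d) \<in> param_proj r s `
      zero_set (all_vars n r s) (iso_system n a b F0 F1) (H0 \<union> H1)"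
proof -
  interpret PX: parametric_lie_algebra scaleX n X "c_vars r" "zero_set (c_vars r) F0 H0" a bracketX
    by fact
  interpret PY: parametric_lie_algebra scaleY n Y "d_vars s" "zero_set (d_vars s) F1 H1" b bracketY
    by fact
  interpret based_lie_algebra_pair scaleX scaleY n X Y "bracketX c" "bracketY d"
    "\<lambda>i j k. eval_poly c (a i j k)" "\<lambda>i j k. eval_poly d (b i j k)"
    using PX.based_lie_algebra_at[OF assms(11)] PY.based_lie_algebra_at[OF assms(12)]
    by (rule based_lie_algebra_pair.intro)
  let ?det = "\<lambda>z. det (mat n n (\<lambda>(j, i). z (Suc i) (Suc j))) :: complex"
  let ?hom = "\<lambda>z. \<forall>i j t. 1 \<le> i \<and> i < j \<and> j \<le> n \<and> 1 \<le> t \<and> t \<le> n \<longrightarrow>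
      (\<Sum>k = 1..n. z k t * eval_poly c (a i j k))
        - (\<Sum>k = 1..n. \<Sum>l = 1..n. z i k * z j l * eval_poly d (b k l t)) = 0"
  \<comment> \<open>\<open>a i j k\<close> involves only the variables in \<open>c_vars r\<close>,
    so any point lying above \<open>c\<close> gives it its value at \<open>c\<close>.\<close>
  have eval_a: "eval_poly p (a i j k) = eval_poly c (a i j k)"
    if "restrict p (c_vars r) = c" "i \<in> {1..n}" "j \<in> {1..n}" "k \<in> {1..n}" for p i j k
    by (rule eval_poly_cong[OF PX.coeff_poly[OF that(2-4)]]) (use that(1) in auto)
  have eval_b: "eval_poly p (b i j k) = eval_poly d (b i j k)"
    if "restrict p (d_vars s) = d" "i \<in> {1..n}" "j \<in> {1..n}" "k \<in> {1..n}" for p i j k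
    by (rule eval_poly_cong[OF PY.coeff_poly[OF that(2-4)]]) (use that(1) in auto)
  \<comment> \<open>In the fibre over \<open>(c, d)\<close> the constraints from \<open>F0\<close>,
    \<open>F1\<close>, \<open>H0\<close> and \<open>H1\<close> hold automatically; the bracket and
    determinant equations remain.\<close>
  have zero_iff: "p \<in> zero_set (all_vars n r s) (iso_system n a b F0 F1) (H0 \<union> H1) \<longleftrightarrow>
      p \<in> all_vars n r s \<rightarrow>\<^sub>E UNIV \<and> ?hom (\<lambda>i j. p (ZZ i j)) \<and> p Z * ?det (\<lambda>i j. p (ZZ i j)) = 1"
    if "restrict p (c_vars r) = c" "restrict p (d_vars s) = d" for p
  proof -
    have "(\<forall>f \<in> F0. eval_poly p f = 0) \<and> (\<forall>h \<in> H0. eval_poly p h \<noteq> 0)"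
      using assms(11) unfolding that(1)[symmetric] zero_set_restrict[OF assms(3,4)] .
    moreover have "(\<forall>f \<in> F1. eval_poly p f = 0) \<and> (\<forall>h \<in> H1. eval_poly p h \<noteq> 0)"
      using assms(12) unfolding that(2)[symmetric] zero_set_restrict[OF assms(7,8)] .
    moreover have "(\<Sum>k = 1..n. p (ZZ k t) * eval_poly p (a i j k))
          - (\<Sum>k = 1..n. \<Sum>l = 1..n. p (ZZ i k) * p (ZZ j l) * eval_poly p (b k l t)) =
        (\<Sum>k = 1..n. p (ZZ k t) * eval_poly c (a i j k))
          - (\<Sum>k = 1..n. \<Sum>l = 1..n. p (ZZ i k) * p (ZZ j l) * eval_poly d (b k l t))"
      if "1 \<le> i \<and> i < j \<and> j \<le> n \<and> 1 \<le> t \<and> t \<le> n" for i j t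
      using that eval_a[OF \<open>restrict p (c_vars r) = c\<close>] eval_b[OF \<open>restrict p (d_vars s) = d\<close>]
      by (intro arg_cong2[of _ _ _ _ "(-)"] sum.cong refl arg_cong2[of _ _ _ _ "(*)"]) auto
    ultimately show ?thesis
      unfolding zero_set_def iso_system_zero_iff by auto
  qed
  show ?thesis
    unfolding lie_isomorphic_iff_coefficients
  proof
    assume "\<exists>z. ?det z \<noteq> 0 \<and> ?hom z"
    then obtain z where z: "?det z \<noteq> 0" "?hom z" by blast
    \<comment> \<open>The unknown \<open>Z\<close> receives the inverse determinant, the
      \<open>ZZ i j\<close> the coefficients of the isomorphism, and the parameter variables the
      values of \<open>c\<close> and \<open>d\<close>.\<close>
    define p where "p = restrict (\<lambda>v. case v of Z \<Rightarrow> inverse (?det z) | ZZ i j \<Rightarrow> z i j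
      | Par_c i \<Rightarrow> c v | Par_d i \<Rightarrow> d v) (all_vars n r s)"
    \<comment> \<open>Since \<open>c\<close> is itself extensional, agreement on
      \<open>c_vars r\<close> gives equality of points.\<close>
    have c: "restrict p (c_vars r) = c"
    proof (rule extensionalityI)
      show "c \<in> extensional (c_vars r)" using assms(11) by (auto simp: zero_set_def PiE_def)
    qed (auto simp: p_def c_vars_def all_vars_def)
    have d: "restrict p (d_vars s) = d"
    proof (rule extensionalityI)
      show "d \<in> extensional (d_vars s)" using assms(12) by (auto simp: zero_set_def PiE_def)
    qed (auto simp: p_def d_vars_def all_vars_def)
    have ZZ: "p (ZZ i j) = z i j" if "i \<in> {1..n}" "j \<in> {1..n}" for i j
      using that by (auto simp: p_def all_vars_def)
    \<comment> \<open>Positions below \<open>n\<close> become indices in \<open>{1..n}\<close> under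
      \<open>Suc\<close>, where \<open>p\<close> is known to agree with \<open>z\<close>.\<close>
    have "mat n n (\<lambda>(j, i). p (ZZ (Suc i) (Suc j))) = mat n n (\<lambda>(j, i). z (Suc i) (Suc j))"
      by (rule eq_matI) (auto simp: ZZ)
    then have "p Z * ?det (\<lambda>i j. p (ZZ i j)) = 1"
      using z(1) by (simp add: p_def all_vars_def)
    moreover have "?hom (\<lambda>i j. p (ZZ i j))"
      using z(2) by (simp add: ZZ)
    moreover have "p \<in> all_vars n r s \<rightarrow>\<^sub>E UNIV"
      by (simp add: p_def PiE_def)
    ultimately have "p \<in> zero_set (all_vars n r s) (iso_system n a b F0 F1) (H0 \<union> H1)"
      by (simp only: zero_iff[OF c d])
    moreover have "(c, d) = param_proj r s p"
      by (simp add: param_proj_def c d)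
    ultimately show "(c, d) \<in> param_proj r s `
        zero_set (all_vars n r s) (iso_system n a b F0 F1) (H0 \<union> H1)"
      by blast
  next
    assume "(c, d) \<in> param_proj r s `
      zero_set (all_vars n r s) (iso_system n a b F0 F1) (H0 \<union> H1)"
    then obtain p where p: "p \<in> zero_set (all_vars n r s) (iso_system n a b F0 F1) (H0 \<union> H1)"
      and c: "restrict p (c_vars r) = c" and d: "restrict p (d_vars s) = d"
      unfolding param_proj_def by (elim imageE) (metis prod.inject)
    \<comment> \<open>The coordinates of the point are the coefficients sought; \<open>p Z\<close>
      times the determinant is 1, so the determinant is nonzero.\<close>
    define z where "z = (\<lambda>i j. p (ZZ i j))"
    have "?hom z" "?det z \<noteq> 0"
      using p unfolding zero_iff[OF c d] z_def by auto
    then show "\<exists>z. ?det z \<noteq> 0 \<and> ?hom z" by blast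
  qed
qed

end
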